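(* Let $(X,\mathcal R)$ be an imprimitive symmetric association scheme with a fixed imprimitivity system (a partition $\mathcal F$ of $X$ into fibres). Then $(X,\mathcal R)$ is dismantlable if and only if it is uniform.
   Context: A (symmetric) $d$-class association scheme $(X,\mathcal R)$ consists of a finite set $X$ and a partition $\mathcal R=\{R_0,\dots,R_d\}$ of $X\times X$ with $R_0=\{(x,x):x\in X\}$, each $R_i$ symmetric, and integers $p^h_{ij}$ such that for $(x,y)\in R_h$ the number of $z$ with $(x,z)\in R_i,(z,y)\in R_j$ equals $p^h_{ij}$. $A_i$ denotes the adjacency matrix of $R_i$. The scheme is imprimitive if some nontrivial relation is disconnected as a graph; then there is a set $\mathcal I$ with $\{0\}\subsetneq\mathcal I\subsetneq\{0,\dots,d\}$ such that $\bigcup_{i\in\mathcal I}R_i$ is an equivalence relation whose classes (the fibres, forming the imprimitivity system $\mathcal F$) all have the same size $n$; let $w$ be the number of fibres. For fibres $U,V$ let $\mathcal I(U,V)$ be the set of $i$ with $R_i\cap(U\times V)\neq\emptyset$, and for a matrix $M$ indexed by $X$ let $M^{UV}$ be the matrix agreeing with $M$ on $U\times V$ and zero elsewhere. The scheme is uniform if its quotient is trivial, i.e. $\mathcal I(U,V)=\{0,\dots,d\}\setminus\mathcal I$ for all distinct fibres $U,V$, and there are integers $a^h_{ij}$ such that for all fibres $U,V,W$ (not necessarily distinct) and all $i\in\mathcal I(U,V)$, $j\in\mathcal I(V,W)$ we have $A_i^{UV}A_j^{VW}=\sum_h a^h_{ij}A_h^{UW}$. The scheme is dismantlable if for every union $Y$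 of fibres, the nonempty relations among $R_i\cap(Y\times Y)$, $i=0,\dots,d$, form an association scheme on $Y$ (called a dismantled scheme when $Y$ is a union of at least two fibres). *)

theory Defs
  imports Main "HOL-Library.Disjoint_Sets"
begin

definition association_scheme :: "'a set \<Rightarrow> nat \<Rightarrow> (nat \<Rightarrow> ('a \<times> 'a) set) \<Rightarrow> bool" where
  "association_scheme X d R \<longleftrightarrow>
     finite X \<and>
     inj_on R {0..d} \<and> partition_on (X \<times> X) (R ` {0..d}) \<and>
     R 0 = Id_on X \<and>
     (\<forall>i\<in>{0..d}. sym (R i)) \<and>
     (\<exists>p :: nat \<Rightarrow> nat \<Rightarrow> nat \<Rightarrow> int.
        \<forall>h\<in>{0..d}. \<forall>i\<in>{0..d}. \<forall>j\<in>{0..d}. \<forall>(x, y)\<in>R h.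
          int (card {z \<in> X. (x, z) \<in> R i \<and> (z, y) \<in> R j}) = p h i j)"

definition imprimitive :: "'a set \<Rightarrow> nat \<Rightarrow> (nat \<Rightarrow> ('a \<times> 'a) set) \<Rightarrow> bool" where
  "imprimitive X d R \<longleftrightarrow> (\<exists>i\<in>{1..d}. \<exists>x\<in>X. \<exists>y\<in>X. (x, y) \<notin> (R i)\<^sup>*)"

text \<open>An imprimitivity system \<open>F\<close> together with the index set \<open>I\<close> of the relations
  whose union is the equivalence relation with classes \<open>F\<close>.\<close>

definition imprimitivity_system ::
  "'a set \<Rightarrow> nat \<Rightarrow> (nat \<Rightarrow> ('a \<times> 'a) set) \<Rightarrow> nat set \<Rightarrow> 'a set set \<Rightarrow> bool" where
  "imprimitivity_system X d R I F \<longleftrightarrow>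
     {0} \<subset> I \<and> I \<subset> {0..d} \<and>
     equiv X (\<Union>i\<in>I. R i) \<and> F = X // (\<Union>i\<in>I. R i)"

definition index_set :: "nat \<Rightarrow> (nat \<Rightarrow> ('a \<times> 'a) set) \<Rightarrow> 'a set \<Rightarrow> 'a set \<Rightarrow> nat set" where
  "index_set d R U V = {i \<in> {0..d}. R i \<inter> (U \<times> V) \<noteq> {}}"

text \<open>Matrices indexed by \<open>X\<close> are functions of two arguments; those used below vanish
  outside \<open>X \<times> X\<close>.\<close>

definition adjacency :: "('a \<times> 'a) set \<Rightarrow> 'a \<Rightarrow> 'a \<Rightarrow> int" where
  "adjacency E x y = (if (x, y) \<in> E then 1 else 0)"

definition block :: "('a \<Rightarrow> 'a \<Rightarrow> int) \<Rightarrow> 'a set \<Rightarrow> 'a set \<Rightarrow> 'a \<Rightarrow> 'a \<Rightarrow> int" where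
  "block M U V x y = (if x \<in> U \<and> y \<in> V then M x y else 0)"

definition matrix_prod ::
  "'a set \<Rightarrow> ('a \<Rightarrow> 'a \<Rightarrow> int) \<Rightarrow> ('a \<Rightarrow> 'a \<Rightarrow> int) \<Rightarrow> 'a \<Rightarrow> 'a \<Rightarrow> int" where
  "matrix_prod X M N x y = (\<Sum>z\<in>X. M x z * N z y)"

definition uniform ::
  "'a set \<Rightarrow> nat \<Rightarrow> (nat \<Rightarrow> ('a \<times> 'a) set) \<Rightarrow> nat set \<Rightarrow> 'a set set \<Rightarrow> bool" where
  "uniform X d R I F \<longleftrightarrow>
     (\<forall>U\<in>F. \<forall>V\<in>F. U \<noteq> V \<longrightarrow> index_set d R U V = {0..d} - I) \<and>
     (\<exists>a :: nat \<Rightarrow> nat \<Rightarrow> nat \<Rightarrow> int.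
        \<forall>U\<in>F. \<forall>V\<in>F. \<forall>W\<in>F. \<forall>i\<in>index_set d R U V. \<forall>j\<in>index_set d R V W.
          matrix_prod X (block (adjacency (R i)) U V) (block (adjacency (R j)) V W) =
          (\<lambda>x y. \<Sum>h\<in>{0..d}. a h i j * block (adjacency (R h)) U W x y))"

definition forms_association_scheme :: "'a set \<Rightarrow> ('a \<times> 'a) set set \<Rightarrow> bool" where
  "forms_association_scheme Y S \<longleftrightarrow> (\<exists>e Q. association_scheme Y e Q \<and> Q ` {0..e} = S)"

text \<open>The empty union is excluded: it carries no nonempty relation at all.\<close>

definition dismantlable ::
  "nat \<Rightarrow> (nat \<Rightarrow> ('a \<times> 'a) set) \<Rightarrow> 'a set set \<Rightarrow> bool" where
  "dismantlable d R F \<longleftrightarrow>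
     (\<forall>G. G \<subseteq> F \<and> G \<noteq> {} \<longrightarrow>
        forms_association_scheme (\<Union>G)
          ((\<lambda>i. R i \<inter> (\<Union>G \<times> \<Union>G)) ` {0..d} - {{}}))"

end

theory Submission
  imports Defs
begin

text \<open>Counting paths \<open>x - z - y\<close> of type \<open>(i, j)\<close> with \<open>z\<close> in a single fibre \<open>V\<close> is additive over
  unions of fibres. Given uniformity, a union \<open>Y\<close> of fibres therefore has as intersection number
  \<open>a h i j\<close> times the number of admissible fibres inside \<open>Y\<close>, which depends only on which of
  \<open>h, i, j\<close> lie in \<open>I\<close>. Conversely, dismantling to three fibres makes every relation regular on
  them, and a loopless regular graph on three points is empty or complete, so the quotient is
  trivial. The fibrewise counts are the intersection numbers of dismantled schemes on two fibres
  (if \<open>h \<in> I\<close>) or three fibres (if \<open>h \<notin> I\<close>); comparing two such schemes inside the one with one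
  more fibre shows that exchanging a single fibre does not change them.\<close>

section \<open>Path counts and regular subsets\<close>

definition path_count :: "(nat \<Rightarrow> ('a \<times> 'a) set) \<Rightarrow> nat \<Rightarrow> nat \<Rightarrow> 'a set \<Rightarrow> 'a \<Rightarrow> 'a \<Rightarrow> nat" where
  "path_count R i j Y x y = card {z \<in> Y. (x, z) \<in> R i \<and> (z, y) \<in> R j}"

text \<open>This is the intersection-number axiom on \<open>Y\<close>, phrased with the indices of
  the ambient scheme, so that relations empty on \<open>Y\<close> force no renumbering.\<close>

definition regular_on :: "nat \<Rightarrow> (nat \<Rightarrow> ('a \<times> 'a) set) \<Rightarrow> 'a set \<Rightarrow> bool" where
  "regular_on d R Y \<longleftrightarrow>
     (\<forall>h\<le>d. \<forall>i\<le>d. \<forall>j\<le>d. \<forall>x\<in>Y. \<forall>y\<in>Y. \<forall>x'\<in>Y. \<forall>y'\<in>Y.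
        (x, y) \<in> R h \<longrightarrow> (x', y') \<in> R h \<longrightarrow> path_count R i j Y x y = path_count R i j Y x' y')"

lemma regular_onD:
  assumes "regular_on d R Y" "h \<le> d" "i \<le> d" "j \<le> d" "x \<in> Y" "y \<in> Y" "x' \<in> Y" "y' \<in> Y"
    "(x, y) \<in> R h" "(x', y') \<in> R h"
  shows "path_count R i j Y x y = path_count R i j Y x' y'"
  using assms unfolding regular_on_def by blast

lemma path_count_pos_iff:
  assumes "finite Y"
  shows "path_count R i j Y x y > 0 \<longleftrightarrow> (\<exists>z\<in>Y. (x, z) \<in> R i \<and> (z, y) \<in> R j)"
  using assms unfolding path_count_def by (auto simp: card_gt_0_iff)

lemma path_count_Un:
  assumes "finite Y" "finite Z" "Y \<inter> Z = {}"
  shows "path_count R i j (Y \<union> Z) x y = path_count R i j Y x y + path_count R i j Z x y"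
proof -
  have "{z \<in> Y \<union> Z. (x, z) \<in> R i \<and> (z, y) \<in> R j} =
      {z \<in> Y. (x, z) \<in> R i \<and> (z, y) \<in> R j} \<union> {z \<in> Z. (x, z) \<in> R i \<and> (z, y) \<in> R j}"
    by auto
  then show ?thesis
    using assms unfolding path_count_def by (auto intro!: card_Un_disjoint)
qed

lemma path_count_Union:
  assumes "finite G" "\<And>V. V \<in> G \<Longrightarrow> finite V" "disjoint G"
  shows "path_count R i j (\<Union>G) x y = (\<Sum>V\<in>G. path_count R i j V x y)"
  using assms
proof (induction G rule: finite_induct)
  case empty
  then show ?case by (simp add: path_count_def)
next
  case (insert V G)
  then have "V \<inter> \<Union>G = {}" by (auto simp: disjoint_def)
  with insert show ?case
    by (simp add: path_count_Un disjoint_def)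
qed

text \<open>Swapping some \<open>a\<close> in \<open>S - T\<close> for some \<open>b\<close> in
  \<open>T - S\<close> keeps the size and brings \<open>S\<close> one element closer to
  \<open>T\<close>, so finitely many exchanges lead from \<open>S\<close> to
  \<open>T\<close>.\<close>

lemma exchange_invariant_constant:
  assumes step: "\<And>S a b. finite S \<Longrightarrow> S \<subseteq> F \<Longrightarrow> a \<in> F - S \<Longrightarrow> b \<in> F - S \<Longrightarrow> a \<noteq> b \<Longrightarrow>
      Suc (card S) = k \<Longrightarrow> f (insert a S) = f (insert b S)"
    and "finite S" "finite T" "S \<subseteq> F" "T \<subseteq> F" "card S = k" "card T = k"
  shows "f S = f T"
  using assms(2-)
proof (induction "card (S - T)" arbitrary: S)
  case 0
  then have "S \<subseteq> T" by simp
  with 0 show ?case by (metis card_subset_eq)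
next
  case (Suc n)
  from Suc.hyps(2) have "S - T \<noteq> {}" by (metis card.empty nat.distinct(1))
  then obtain a where a: "a \<in> S" "a \<notin> T" by blast
  have "\<not> T \<subseteq> S" using a Suc.prems by (metis card_subset_eq)
  then obtain b where b: "b \<in> T" "b \<notin> S" by blast
  let ?S = "S - {a}"
  have S: "S = insert a ?S" using a by blast
  have card: "Suc (card ?S) = k" using card_Suc_Diff1[of S a] a Suc.prems by simp
  have "f S = f (insert b ?S)"
    using step[of ?S a b] a b Suc.prems card S by auto
  also have "\<dots> = f T"
  proof (rule Suc.hyps(1))
    have "insert b ?S - T = (S - T) - {a}" using b by auto
    then show "n = card (insert b ?S - T)" using Suc.hyps(2) a Suc.prems by simp
    show "card (insert b ?S) = k" using card b Suc.prems by simp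
  qed (use b Suc.prems in auto)
  finally show ?case .
qed

text \<open>To be used with \<open>P\<close> as \<open>i \<in> I\<close> and \<open>Q\<close> as
  \<open>j \<in> I\<close>: when the quotient is trivial, this counts the middle fibres through
  which paths of type \<open>(i, j)\<close> from \<open>U\<close> to \<open>W\<close> can run. The
  fibres \<open>U\<close> and \<open>W\<close> enter only through whether they coincide. The
  subtractions never truncate, since \<open>G\<close> contains both.\<close>

lemma admissible_fibres_card:
  assumes "finite G" "U \<in> G" "W \<in> G"
  shows "card {V \<in> G. (U = V \<longleftrightarrow> P) \<and> (V = W \<longleftrightarrow> Q)} =
    (if P then (if (U = W) = Q then 1 else 0)
     else if Q then (if U = W then 0 else 1)
     else if U = W then card G - 1 else card G - 2)"
proof -
  have "{V \<in> G. (U = V \<longleftrightarrow> P) \<and> (V = W \<longleftrightarrow> Q)} =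
    (if P then (if (U = W) = Q then {U} else {})
     else if Q then (if U = W then {} else {W})
     else if U = W then G - {U} else G - {U, W})"
    using assms by auto
  then show ?thesis using assms by (simp add: card_Diff_subset numeral_2_eq_2)
qed

section \<open>Schemes and their restrictions to subsets\<close>

locale scheme =
  fixes X :: "'a set" and d :: nat and R :: "nat \<Rightarrow> ('a \<times> 'a) set"
  assumes scheme: "association_scheme X d R"
begin

lemma finite_X: "finite X"
  using scheme unfolding association_scheme_def by blast

lemma R_partition: "partition_on (X \<times> X) (R ` {0..d})"
  using scheme unfolding association_scheme_def by blast

lemma R_subset: "i \<le> d \<Longrightarrow> (x, y) \<in> R i \<Longrightarrow> x \<in> X \<and> y \<in> X"
  using partition_onD1[OF R_partition] by (metis SigmaE2 UN_I atLeast0AtMost atMost_iff)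

lemma R_exists:
  assumes "x \<in> X" "y \<in> X"
  obtains h where "h \<le> d" "(x, y) \<in> R h"
proof -
  have "(x, y) \<in> \<Union>(R ` {0..d})" using partition_onD1[OF R_partition] assms by auto
  then show thesis using that by auto
qed

lemma R_unique:
  assumes "i \<le> d" "j \<le> d" "(x, y) \<in> R i" "(x, y) \<in> R j"
  shows "i = j"
proof -
  have "R i = R j"
    using disjointD[OF partition_onD2[OF R_partition], of "R i" "R j"] assms by auto
  moreover have "inj_on R {0..d}" using scheme unfolding association_scheme_def by blast
  ultimately show ?thesis using assms by (auto dest: inj_onD)
qed

lemma R_nonempty:
  assumes "i \<le> d"
  obtains x y where "(x, y) \<in> R i"
proof -
  have "R i \<noteq> {}" using partition_onD3[OF R_partition] assms by force
  then show thesis using that by auto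
qed

lemma R_0: "R 0 = Id_on X"
  using scheme unfolding association_scheme_def by blast

lemma R_sym: "i \<le> d \<Longrightarrow> (x, y) \<in> R i \<Longrightarrow> (y, x) \<in> R i"
  using scheme unfolding association_scheme_def by (auto dest: symD)

text \<open>If \<open>R i\<close> or \<open>R j\<close> is empty on \<open>Y\<close>, there are no
  paths and both counts vanish. Otherwise all three relations have an index in the enumeration
  \<open>Q\<close>, and both counts are the same intersection number of \<open>Q\<close>.\<close>

lemma forms_association_scheme_regular:
  assumes "Y \<subseteq> X"
    and forms: "forms_association_scheme Y ((\<lambda>i. R i \<inter> (Y \<times> Y)) ` {0..d} - {{}})"
  shows "regular_on d R Y"
  unfolding regular_on_def
proof (intro allI impI ballI)
  fix h i j x y x' y'
  assume le: "h \<le> d" "i \<le> d" "j \<le> d" and Y: "x \<in> Y" "y \<in> Y" "x' \<in> Y" "y' \<in> Y"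
    and R: "(x, y) \<in> R h" "(x', y') \<in> R h"
  obtain e Q where Q: "association_scheme Y e Q"
    and im: "Q ` {0..e} = (\<lambda>i. R i \<inter> (Y \<times> Y)) ` {0..d} - {{}}"
    using forms unfolding forms_association_scheme_def by blast
  have index: "\<exists>k\<in>{0..e}. Q k = R m \<inter> (Y \<times> Y)" if "m \<le> d" "R m \<inter> (Y \<times> Y) \<noteq> {}" for m
  proof -
    have "R m \<inter> (Y \<times> Y) \<in> Q ` {0..e}" unfolding im using that by auto
    then show ?thesis by auto
  qed
  obtain p :: "nat \<Rightarrow> nat \<Rightarrow> nat \<Rightarrow> int" where
    p: "\<forall>h\<in>{0..e}. \<forall>i\<in>{0..e}. \<forall>j\<in>{0..e}. \<forall>(x, y)\<in>Q h.
          int (card {z \<in> Y. (x, z) \<in> Q i \<and> (z, y) \<in> Q j}) = p h i j"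
    using Q unfolding association_scheme_def by blast
  show "path_count R i j Y x y = path_count R i j Y x' y'"
  proof (cases "R i \<inter> (Y \<times> Y) = {} \<or> R j \<inter> (Y \<times> Y) = {}")
    case True
    then have "{z \<in> Y. (x, z) \<in> R i \<and> (z, y) \<in> R j} = {}"
      "{z \<in> Y. (x', z) \<in> R i \<and> (z, y') \<in> R j} = {}"
      using Y by auto
    then show ?thesis unfolding path_count_def by (simp only:)
  next
    case False
    then obtain h' i' j' where idx: "h' \<in> {0..e}" "i' \<in> {0..e}" "j' \<in> {0..e}"
      "Q h' = R h \<inter> (Y \<times> Y)" "Q i' = R i \<inter> (Y \<times> Y)" "Q j' = R j \<inter> (Y \<times> Y)"
      using index[of h] index[of i] index[of j] le Y R by blast
    have count: "int (path_count R i j Y u v) = p h' i' j'"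
      if "u \<in> Y" "v \<in> Y" "(u, v) \<in> R h" for u v
    proof -
      have "{z \<in> Y. (u, z) \<in> R i \<and> (z, v) \<in> R j} = {z \<in> Y. (u, z) \<in> Q i' \<and> (z, v) \<in> Q j'}"
        using that idx by auto
      moreover have "(u, v) \<in> Q h'" using that idx by blast
      ultimately show ?thesis using p idx(1-3) unfolding path_count_def by fastforce
    qed
    show ?thesis using count[of x y] count[of x' y'] Y R by simp
  qed
qed

text \<open>Regularity supplies the intersection numbers; the remaining work is to number the
  nonempty restrictions consecutively with the diagonal in position 0.\<close>

lemma regular_forms_association_scheme:
  assumes "Y \<subseteq> X" "Y \<noteq> {}" and reg: "regular_on d R Y"
  shows "forms_association_scheme Y ((\<lambda>i. R i \<inter> (Y \<times> Y)) ` {0..d} - {{}})"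
proof -
  define T where "T i = R i \<inter> (Y \<times> Y)" for i
  define J where "J = {i \<in> {0..d}. T i \<noteq> {}}"
  have fin: "finite J" unfolding J_def by simp
  have T0: "T 0 = Id_on Y" using R_0 assms(1) unfolding T_def by auto
  then have J0: "0 \<in> J" using assms(2) unfolding J_def by auto
  obtain g where g: "bij_betw g {0..<card (J - {0})} (J - {0})"
    using ex_bij_betw_nat_finite fin by blast
  define e where "e = card (J - {0})"
  \<comment> \<open>The new index 0 is reserved for the diagonal; positions from 1 on follow the
    arbitrary enumeration \<open>g\<close>, shifted by one.\<close>
  define b where "b k = (case k of 0 \<Rightarrow> 0 | Suc m \<Rightarrow> g m)" for k
  have split: "{0..e} = insert 0 (Suc ` {0..<e})"
    by (metis atLeast0LessThan atLeast0AtMost image_Suc_lessThan lessThan_Suc_atMost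
        lessThan_Suc_eq_insert_0)
  have b0: "b 0 = 0" and bSuc: "b (Suc m) = g m" for m by (simp_all add: b_def)
  have gim: "g ` {0..<e} = J - {0}" and ginj: "inj_on g {0..<e}"
    using g unfolding e_def bij_betw_def by auto
  have bim: "b ` {0..e} = J"
    unfolding split image_insert image_image bSuc gim b0 using J0 by blast
  have "inj_on b (Suc ` {0..<e})"
    using ginj unfolding inj_on_def ball_simps bSuc by simp
  moreover have "b 0 \<notin> b ` Suc ` {0..<e}"
    unfolding image_image bSuc gim b0 by simp
  ultimately have binj: "inj_on b {0..e}" unfolding split by auto
  have bJ: "b k \<in> J" if "k \<in> {0..e}" for k using bim that by blast
  then have bd: "b k \<le> d" if "k \<in> {0..e}" for k using that unfolding J_def by auto
  have Tinj: "inj_on T J"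
  proof (rule inj_onI)
    fix i j assume ij: "i \<in> J" "j \<in> J" "T i = T j"
    then obtain x y where "(x, y) \<in> T i" "(x, y) \<in> T j" unfolding J_def by auto
    then show "i = j" using R_unique[of i j x y] ij unfolding T_def J_def by auto
  qed
  have im: "(\<lambda>k. T (b k)) ` {0..e} = T ` {0..d} - {{}}"
    using bim unfolding image_image[symmetric, of T b] J_def by auto
  have part: "partition_on (Y \<times> Y) (T ` {0..d} - {{}})"
  proof (rule partition_onI)
    have "\<Union>(T ` {0..d}) = Y \<times> Y"
    proof
      show "Y \<times> Y \<subseteq> \<Union>(T ` {0..d})"
      proof clarify
        fix x y assume "x \<in> Y" "y \<in> Y"
        moreover from this assms(1) obtain h where "h \<le> d" "(x, y) \<in> R h"
          using R_exists by blast
        ultimately show "(x, y) \<in> \<Union>(T ` {0..d})" unfolding T_def by auto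
      qed
    qed (auto simp: T_def)
    moreover have "\<Union>(T ` {0..d} - {{}}) = \<Union>(T ` {0..d})" by blast
    ultimately show "\<Union>(T ` {0..d} - {{}}) = Y \<times> Y" by simp
    show "disjnt p q" if "p \<in> T ` {0..d} - {{}}" "q \<in> T ` {0..d} - {{}}" "p \<noteq> q" for p q
      using that R_unique unfolding T_def disjnt_def by fastforce
  qed auto
  \<comment> \<open>The intersection number is read off an arbitrarily chosen pair of the relation;
    regularity makes the choice irrelevant.\<close>
  define p where "p h i j = (let (x, y) = (SOME q. q \<in> T (b h)) in
      int (path_count R (b i) (b j) Y x y))" for h i j
  have p: "int (card {z \<in> Y. (x, z) \<in> T (b i) \<and> (z, y) \<in> T (b j)}) = p h i j"
    if hij: "h \<in> {0..e}" "i \<in> {0..e}" "j \<in> {0..e}" and xy: "(x, y) \<in> T (b h)" for h i j x y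
  proof -
    obtain x' y' where q: "(SOME q. q \<in> T (b h)) = (x', y')" by fastforce
    have xy': "(x', y') \<in> T (b h)" using someI[of "\<lambda>q. q \<in> T (b h)", OF xy] q by simp
    have "{z \<in> Y. (x, z) \<in> T (b i) \<and> (z, y) \<in> T (b j)} =
        {z \<in> Y. (x, z) \<in> R (b i) \<and> (z, y) \<in> R (b j)}"
      using xy unfolding T_def by auto
    moreover have "path_count R (b i) (b j) Y x y = path_count R (b i) (b j) Y x' y'"
      using regular_onD[OF reg bd[OF hij(1)] bd[OF hij(2)] bd[OF hij(3)]] xy xy'
      unfolding T_def by blast
    ultimately show ?thesis unfolding p_def q path_count_def by simp
  qed
  have "association_scheme Y e (\<lambda>k. T (b k))"
    unfolding association_scheme_def
  proof (intro conjI)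
    show "finite Y" using assms(1) finite_X finite_subset by blast
    show "inj_on (\<lambda>k. T (b k)) {0..e}"
      using comp_inj_on[OF binj, of T] Tinj bim by (simp add: comp_def)
    show "partition_on (Y \<times> Y) ((\<lambda>k. T (b k)) ` {0..e})" using part im by simp
    show "T (b 0) = Id_on Y" using T0 b0 by simp
    show "\<forall>i\<in>{0..e}. sym (T (b i))"
      using R_sym bd unfolding T_def by (auto intro!: symI)
    show "\<exists>p :: nat \<Rightarrow> nat \<Rightarrow> nat \<Rightarrow> int. \<forall>h\<in>{0..e}. \<forall>i\<in>{0..e}. \<forall>j\<in>{0..e}. \<forall>(x, y)\<in>T (b h).
        int (card {z \<in> Y. (x, z) \<in> T (b i) \<and> (z, y) \<in> T (b j)}) = p h i j"
      using p by blast
  qed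
  then show ?thesis
    unfolding forms_association_scheme_def T_def[symmetric] using im by blast
qed

lemma regular_X: "regular_on d R X"
proof (rule forms_association_scheme_regular)
  have "R i \<inter> (X \<times> X) = R i" "R i \<noteq> {}" if "i \<in> {0..d}" for i
    using that R_subset[of i] R_nonempty[of i] by auto
  then have "(\<lambda>i. R i \<inter> (X \<times> X)) ` {0..d} - {{}} = R ` {0..d}" by auto
  then show "forms_association_scheme X ((\<lambda>i. R i \<inter> (X \<times> X)) ` {0..d} - {{}})"
    unfolding forms_association_scheme_def using scheme by metis
qed simp

text \<open>An intersection number that is positive for one pair of \<open>R h\<close> is positive
  for all of them.\<close>

lemma path_transfer:
  assumes "h \<le> d" "i \<le> d" "j \<le> d" "(x, z) \<in> R i" "(z, y) \<in> R j" "(x, y) \<in> R h" "(x', y') \<in> R h"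
  obtains z' where "(x', z') \<in> R i" "(z', y') \<in> R j"
proof -
  have X: "x \<in> X" "y \<in> X" "z \<in> X" "x' \<in> X" "y' \<in> X" using R_subset assms by blast+
  have "path_count R i j X x y > 0"
    using path_count_pos_iff[OF finite_X] assms X by metis
  then have "path_count R i j X x' y' > 0"
    using regular_onD[OF regular_X assms(1-3) X(1,2,4,5) assms(6,7)] by simp
  then show thesis using path_count_pos_iff[OF finite_X] that by metis
qed

text \<open>The paths of type \<open>(i, i)\<close> from \<open>x\<close> back to \<open>x\<close>
  count the neighbours of \<open>x\<close> under \<open>R i\<close> in \<open>Y\<close>. Since all
  pairs \<open>(x, x)\<close> lie in \<open>R 0\<close>, this valency is the same at every point of
  \<open>Y\<close>.\<close>

lemma regular_neighbour:
  assumes "Y \<subseteq> X" "regular_on d R Y" "i \<le> d" "x \<in> Y" "z \<in> Y" "(x, z) \<in> R i" "x' \<in> Y"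
  obtains z' where "z' \<in> Y" "(x', z') \<in> R i"
proof -
  have fin: "finite Y" using assms(1) finite_X finite_subset by blast
  have "path_count R i i Y x x > 0"
    using path_count_pos_iff[OF fin] assms R_sym by metis
  moreover have "(x, x) \<in> R 0" "(x', x') \<in> R 0" using R_0 assms by auto
  ultimately have "path_count R i i Y x' x' > 0"
    using regular_onD[OF assms(2), of 0 i i x x x' x'] assms by simp
  then show thesis using path_count_pos_iff[OF fin] that by metis
qed

end

section \<open>Fibres and the quotient\<close>

locale fibred_scheme = scheme +
  fixes I :: "nat set" and F :: "'a set set"
  assumes system: "imprimitivity_system X d R I F"
begin

abbreviation E where "E \<equiv> \<Union>i\<in>I. R i"

lemma equiv_E: "equiv X E" and F_eq: "F = X // E" and I_sub: "I \<subseteq> {0..d}"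
  using system unfolding imprimitivity_system_def by auto

lemma fibre_nonempty: "U \<in> F \<Longrightarrow> U \<noteq> {}"
  using F_eq equiv_E in_quotient_imp_non_empty by metis

lemma fibre_subset: "U \<in> F \<Longrightarrow> U \<subseteq> X"
  using F_eq equiv_E in_quotient_imp_subset by metis

lemma Union_F: "\<Union>F = X"
  using F_eq equiv_E Union_quotient by metis

lemma fibre_finite: "U \<in> F \<Longrightarrow> finite U"
  using fibre_subset finite_X finite_subset by metis

lemma finite_F: "finite F"
  using finite_X Union_F by (metis finite_UnionD)

lemma fibres_disjoint: "U \<in> F \<Longrightarrow> V \<in> F \<Longrightarrow> U \<noteq> V \<Longrightarrow> U \<inter> V = {}"
  using F_eq equiv_E quotient_disj by metis

lemma fibre_eq_iff_E: "U \<in> F \<Longrightarrow> V \<in> F \<Longrightarrow> x \<in> U \<Longrightarrow> y \<in> V \<Longrightarrow> U = V \<longleftrightarrow> (x, y) \<in> E"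
  using F_eq equiv_E quotient_eq_iff by metis

lemma fibre_eq_iff:
  assumes "U \<in> F" "V \<in> F" "x \<in> U" "y \<in> V" "i \<le> d" "(x, y) \<in> R i"
  shows "U = V \<longleftrightarrow> i \<in> I"
proof -
  have "j = i" if "j \<in> I" "(x, y) \<in> R j" for j
    using R_unique[of j i x y] that assms(5,6) I_sub by auto
  then have "(x, y) \<in> E \<longleftrightarrow> i \<in> I" using assms(6) by blast
  then show ?thesis using fibre_eq_iff_E assms by metis
qed

lemma fibre_exists:
  assumes "x \<in> X"
  obtains U where "U \<in> F" "x \<in> U"
  using assms Union_F by blast

lemma index_setI:
  "i \<le> d \<Longrightarrow> x \<in> U \<Longrightarrow> y \<in> V \<Longrightarrow> (x, y) \<in> R i \<Longrightarrow> i \<in> index_set d R U V"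
  unfolding index_set_def by auto

lemma index_setE:
  assumes "i \<in> index_set d R U V"
  obtains x y where "i \<le> d" "x \<in> U" "y \<in> V" "(x, y) \<in> R i"
  using assms unfolding index_set_def by auto

lemma index_set_sym: "i \<in> index_set d R U V \<Longrightarrow> i \<in> index_set d R V U"
  by (metis index_setE index_setI R_sym)

lemma index_set_iff_I:
  "U \<in> F \<Longrightarrow> V \<in> F \<Longrightarrow> i \<in> index_set d R U V \<Longrightarrow> U = V \<longleftrightarrow> i \<in> I"
  by (metis index_setE fibre_eq_iff)

text \<open>Constant valency gives each point of \<open>U\<close> a neighbour under
  \<open>R i\<close>, and for \<open>i\<close> in \<open>I\<close> this neighbour cannot leave the
  fibre.\<close>

lemma index_set_diag:
  assumes "U \<in> F"
  shows "index_set d R U U = I"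
proof
  show "index_set d R U U \<subseteq> I" using index_set_iff_I assms by blast
  show "I \<subseteq> index_set d R U U"
  proof
    fix i assume i: "i \<in> I"
    then have d: "i \<le> d" using I_sub by auto
    obtain x y where xy: "(x, y) \<in> R i" using R_nonempty d by blast
    obtain u where u: "u \<in> U" using fibre_nonempty assms by blast
    have "x \<in> X" "y \<in> X" "u \<in> X" using R_subset[OF d xy] u fibre_subset[OF assms] by auto
    then obtain v where v: "v \<in> X" "(u, v) \<in> R i"
      using regular_neighbour[OF subset_refl regular_X d _ _ xy] by metis
    obtain V where V: "V \<in> F" "v \<in> V" using fibre_exists[OF v(1)] .
    then have "U = V" using fibre_eq_iff[OF assms V(1) u V(2) d v(2)] i by simp
    then show "i \<in> index_set d R U U" using index_setI[OF d u V(2) v(2)] by simp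
  qed
qed

text \<open>The index sets of pairs of fibres are the classes of the quotient scheme, so they are
  equal or disjoint.\<close>

lemma index_set_transfer:
  assumes F: "U \<in> F" "V \<in> F" "U' \<in> F" "V' \<in> F"
    and i: "i \<in> index_set d R U V" "i \<in> index_set d R U' V'" and j: "j \<in> index_set d R U V"
  shows "j \<in> index_set d R U' V'"
proof -
  obtain x y where xy: "i \<le> d" "x \<in> U" "y \<in> V" "(x, y) \<in> R i" using i(1) by (rule index_setE)
  obtain x' y' where xy': "x' \<in> U'" "y' \<in> V'" "(x', y') \<in> R i" using i(2) by (rule index_setE)
  obtain u v where uv: "j \<le> d" "u \<in> U" "v \<in> V" "(u, v) \<in> R j" using j by (rule index_setE)
  have X: "x \<in> X" "y \<in> X" "u \<in> X" "v \<in> X" using xy uv F fibre_subset by blast+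
  obtain s where s: "s \<le> d" "(x, u) \<in> R s" using R_exists X by blast
  obtain t where t: "t \<le> d" "(u, y) \<in> R t" using R_exists X by blast
  obtain r where r: "r \<le> d" "(v, y) \<in> R r" using R_exists X by blast
  have sI: "s \<in> I" using fibre_eq_iff[OF F(1) F(1) xy(2) uv(2) s] by simp
  have rI: "r \<in> I" using fibre_eq_iff[OF F(2) F(2) uv(3) xy(3) r] by simp
  \<comment> \<open>The path \<open>x - u - v - y\<close> with steps \<open>s\<close>,
    \<open>j\<close>, \<open>r\<close> is copied to the endpoints \<open>x'\<close>,
    \<open>y'\<close> one inner vertex at a time, with \<open>t\<close> labelling the chord from
    \<open>u\<close> to \<open>y\<close>. As \<open>s\<close> and \<open>r\<close> lie in
    \<open>I\<close>, the copies stay in \<open>U'\<close> and \<open>V'\<close>.\<close>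
  obtain u' where u': "(x', u') \<in> R s" "(u', y') \<in> R t"
    using path_transfer[OF xy(1) s(1) t(1) s(2) t(2) xy(4) xy'(3)] by blast
  obtain v' where v': "(u', v') \<in> R j" "(v', y') \<in> R r"
    using path_transfer[OF t(1) uv(1) r(1) uv(4) r(2) t(2) u'(2)] by blast
  obtain A where A: "A \<in> F" "u' \<in> A" using fibre_exists R_subset v'(1) uv(1) by blast
  obtain B where B: "B \<in> F" "v' \<in> B" using fibre_exists R_subset v'(1) uv(1) by blast
  have "U' = A" using fibre_eq_iff[OF F(3) A(1) xy'(1) A(2) s(1) u'(1)] sI by simp
  moreover have "B = V'" using fibre_eq_iff[OF B(1) F(4) B(2) xy'(2) r(1) v'(2)] rI by simp
  ultimately show ?thesis using index_setI uv(1) A B v'(1) by blast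
qed

abbreviation trivial_quotient where
  "trivial_quotient \<equiv> \<forall>U\<in>F. \<forall>V\<in>F. U \<noteq> V \<longrightarrow> index_set d R U V = {0..d} - I"

lemma trivial_quotient_index_set_iff:
  assumes "trivial_quotient" "U \<in> F" "V \<in> F" "i \<le> d"
  shows "i \<in> index_set d R U V \<longleftrightarrow> (U = V \<longleftrightarrow> i \<in> I)"
  using assms index_set_diag by (cases "U = V") auto

section \<open>Uniformity and dismantlability in terms of path counts\<close>

lemma matrix_prod_block:
  assumes "U \<in> F" "V \<in> F" "W \<in> F"
  shows "matrix_prod X (block (adjacency (R i)) U V) (block (adjacency (R j)) V W) x y =
    (if x \<in> U \<and> y \<in> W then int (path_count R i j V x y) else 0)"
proof (cases "x \<in> U \<and> y \<in> W")
  case True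
  have "matrix_prod X (block (adjacency (R i)) U V) (block (adjacency (R j)) V W) x y =
      (\<Sum>z\<in>X. if z \<in> V \<and> (x, z) \<in> R i \<and> (z, y) \<in> R j then 1 else 0)"
    unfolding matrix_prod_def block_def adjacency_def using True by (intro sum.cong) auto
  also have "\<dots> = int (card {z \<in> X. z \<in> V \<and> (x, z) \<in> R i \<and> (z, y) \<in> R j})"
    using finite_X by (simp add: sum.If_cases Int_def)
  also have "{z \<in> X. z \<in> V \<and> (x, z) \<in> R i \<and> (z, y) \<in> R j} =
      {z \<in> V. (x, z) \<in> R i \<and> (z, y) \<in> R j}"
    using fibre_subset assms by auto
  finally show ?thesis using True unfolding path_count_def by simp
qed (auto simp: matrix_prod_def block_def)

lemma sum_adjacency_block:
  assumes "h \<le> d" "(x, y) \<in> R h"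
  shows "(\<Sum>k\<in>{0..d}. c k * block (adjacency (R k)) U W x y) =
    (if x \<in> U \<and> y \<in> W then c h else 0)"
proof -
  have "(x, y) \<in> R k \<longleftrightarrow> k = h" if "k \<in> {0..d}" for k
    using R_unique[of k h x y] that assms by auto
  then have "(\<Sum>k\<in>{0..d}. c k * block (adjacency (R k)) U W x y) =
      (\<Sum>k\<in>{0..d}. if k = h then (if x \<in> U \<and> y \<in> W then c h else 0) else 0)"
    by (intro sum.cong) (simp_all add: block_def adjacency_def)
  then show ?thesis using assms by simp
qed

text \<open>The matrix identity is compared entrywise. Outside \<open>U \<times> W\<close> both
  sides vanish; inside, each pair lies in exactly one \<open>R h\<close>, so the linear combination
  reduces to the coefficient of that \<open>h\<close>.\<close>

lemma uniform_iff:
  "uniform X d R I F \<longleftrightarrow> trivial_quotient \<and>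
    (\<exists>a :: nat \<Rightarrow> nat \<Rightarrow> nat \<Rightarrow> int. \<forall>U\<in>F. \<forall>V\<in>F. \<forall>W\<in>F.
      \<forall>i\<in>index_set d R U V. \<forall>j\<in>index_set d R V W. \<forall>h\<le>d. \<forall>x\<in>U. \<forall>y\<in>W. (x, y) \<in> R h \<longrightarrow>
        int (path_count R i j V x y) = a h i j)"
proof -
  have "matrix_prod X (block (adjacency (R i)) U V) (block (adjacency (R j)) V W) =
        (\<lambda>x y. \<Sum>h\<in>{0..d}. c h * block (adjacency (R h)) U W x y) \<longleftrightarrow>
      (\<forall>h\<le>d. \<forall>x\<in>U. \<forall>y\<in>W. (x, y) \<in> R h \<longrightarrow> int (path_count R i j V x y) = c h)"
    (is "?L = ?M \<longleftrightarrow> ?P") if F: "U \<in> F" "V \<in> F" "W \<in> F" for U V W i j c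
  proof
    assume eq: "?L = ?M"
    show ?P
    proof (intro allI ballI impI)
      fix h x y assume h: "h \<le> d" "x \<in> U" "y \<in> W" "(x, y) \<in> R h"
      then show "int (path_count R i j V x y) = c h"
        using fun_cong[OF fun_cong[OF eq], of x y] matrix_prod_block[OF F]
          sum_adjacency_block[OF h(1,4)] by simp
    qed
  next
    assume P: ?P
    show "?L = ?M"
    proof (intro ext)
      fix x y
      show "?L x y = ?M x y"
      proof (cases "x \<in> U \<and> y \<in> W")
        case True
        then obtain h where h: "h \<le> d" "(x, y) \<in> R h"
          using R_exists fibre_subset F by blast
        then show ?thesis
          using P True matrix_prod_block[OF F] sum_adjacency_block[OF h] by simp
      next
        case False
        then show ?thesis using matrix_prod_block[OF F] by (auto simp: block_def)
      qed
    qed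
  qed
  then show ?thesis unfolding uniform_def by simp
qed

lemma dismantlable_iff:
  "dismantlable d R F \<longleftrightarrow> (\<forall>G\<subseteq>F. G \<noteq> {} \<longrightarrow> regular_on d R (\<Union>G))"
proof -
  have "forms_association_scheme (\<Union>G) ((\<lambda>i. R i \<inter> (\<Union>G \<times> \<Union>G)) ` {0..d} - {{}}) \<longleftrightarrow>
      regular_on d R (\<Union>G)" if G: "G \<subseteq> F" "G \<noteq> {}" for G
  proof -
    have "\<Union>G \<subseteq> X" using G fibre_subset by blast
    moreover have "\<Union>G \<noteq> {}" using G fibre_nonempty by blast
    ultimately show ?thesis
      using forms_association_scheme_regular regular_forms_association_scheme by blast
  qed
  then show ?thesis unfolding dismantlable_def by blast
qed

lemma path_count_eq_0:
  assumes F: "U \<in> F" "V \<in> F" "W \<in> F" and "x \<in> U" "y \<in> W" "i \<le> d" "j \<le> d"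
    and "i \<notin> index_set d R U V \<or> j \<notin> index_set d R V W"
  shows "path_count R i j V x y = 0"
proof -
  have "{z \<in> V. (x, z) \<in> R i \<and> (z, y) \<in> R j} = {}"
    using assms index_setI by blast
  then show ?thesis unfolding path_count_def by (metis card.empty)
qed

lemma path_count_fibres:
  assumes "G \<subseteq> F"
  shows "path_count R i j (\<Union>G) x y = (\<Sum>V\<in>G. path_count R i j V x y)"
proof (rule path_count_Union)
  show "finite G" using assms finite_F finite_subset by blast
  show "finite V" if "V \<in> G" for V using that assms fibre_finite by blast
  show "disjoint G" using assms fibres_disjoint unfolding disjoint_def by blast
qed

section \<open>From uniform to dismantlable\<close>

lemma uniform_imp_dismantlable:
  assumes "uniform X d R I F"
  shows "dismantlable d R F"
  unfolding dismantlable_iff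
proof (intro allI impI)
  fix G assume G: "G \<subseteq> F" "G \<noteq> {}"
  obtain a :: "nat \<Rightarrow> nat \<Rightarrow> nat \<Rightarrow> int" where tq: "trivial_quotient"
    and a: "\<forall>U\<in>F. \<forall>V\<in>F. \<forall>W\<in>F. \<forall>i\<in>index_set d R U V. \<forall>j\<in>index_set d R V W.
      \<forall>h\<le>d. \<forall>x\<in>U. \<forall>y\<in>W. (x, y) \<in> R h \<longrightarrow> int (path_count R i j V x y) = a h i j"
    using assms unfolding uniform_iff by blast
  have finG: "finite G" using G finite_F finite_subset by blast
  \<comment> \<open>The factor is the number of admissible middle fibres in \<open>G\<close>, with
    the condition \<open>U = W\<close> rewritten as \<open>h \<in> I\<close>; the right-hand side
    thus no longer mentions \<open>x\<close> and \<open>y\<close>.\<close>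
  have count: "int (path_count R i j (\<Union>G) x y) = a h i j * int
      (if i \<in> I then (if (h \<in> I) = (j \<in> I) then 1 else 0)
       else if j \<in> I then (if h \<in> I then 0 else 1)
       else if h \<in> I then card G - 1 else card G - 2)"
    if le: "h \<le> d" "i \<le> d" "j \<le> d" and xy: "x \<in> \<Union>G" "y \<in> \<Union>G" "(x, y) \<in> R h" for h i j x y
  proof -
    obtain U W where UW: "U \<in> G" "W \<in> G" "x \<in> U" "y \<in> W" using xy by blast
    then have F: "U \<in> F" "W \<in> F" using G by auto
    have hI: "U = W \<longleftrightarrow> h \<in> I" using fibre_eq_iff[OF F UW(3,4) le(1) xy(3)] .
    let ?A = "{V \<in> G. (U = V \<longleftrightarrow> i \<in> I) \<and> (V = W \<longleftrightarrow> j \<in> I)}"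
    have "int (path_count R i j V x y) = (if V \<in> ?A then a h i j else 0)" if V: "V \<in> G" for V
    proof -
      have VF: "V \<in> F" using V G by blast
      have "V \<in> ?A \<longleftrightarrow> i \<in> index_set d R U V \<and> j \<in> index_set d R V W"
        using trivial_quotient_index_set_iff[OF tq] F VF V le by blast
      then show ?thesis
        using a path_count_eq_0[OF F(1) VF F(2) UW(3,4) le(2,3)] F VF UW le xy by auto
    qed
    then have "int (path_count R i j (\<Union>G) x y) = (\<Sum>V\<in>G. if V \<in> ?A then a h i j else 0)"
      unfolding path_count_fibres[OF G(1)] by simp
    also have "\<dots> = (\<Sum>V\<in>?A. a h i j)"
      using finG by (intro sum.mono_neutral_cong_right) auto
    finally have "int (path_count R i j (\<Union>G) x y) = a h i j * int (card ?A)"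
      by simp
    then show ?thesis
      unfolding admissible_fibres_card[OF finG UW(1,2)] hI .
  qed
  show "regular_on d R (\<Union>G)"
    unfolding regular_on_def using count by (metis of_nat_eq_iff)
qed

section \<open>From dismantlable to uniform\<close>

lemma dismantlable_imp_trivial_quotient:
  assumes reg: "\<And>G. G \<subseteq> F \<Longrightarrow> G \<noteq> {} \<Longrightarrow> regular_on d R (\<Union>G)"
  shows "trivial_quotient"
proof -
  \<comment> \<open>Regularity on the three fibres gives a point \<open>w\<close> of
    \<open>W\<close> a neighbour under \<open>R i\<close> among them, and this neighbour lies
    outside \<open>W\<close> because \<open>i\<close> is not in \<open>I\<close>.\<close>
  have third: "i \<in> index_set d R U W \<or> i \<in> index_set d R V W"
    if F: "U \<in> F" "V \<in> F" "W \<in> F" "U \<noteq> V" and i: "i \<in> index_set d R U V" for U V W i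
  proof -
    obtain x y where xy: "i \<le> d" "x \<in> U" "y \<in> V" "(x, y) \<in> R i" using i by (rule index_setE)
    obtain w where w: "w \<in> W" using F fibre_nonempty by blast
    let ?Y = "\<Union>{U, V, W}"
    have YX: "?Y \<subseteq> X" using F fibre_subset by blast
    have "{U, V, W} \<subseteq> F" using F by simp
    from reg[OF this] obtain z where z: "z \<in> ?Y" "(w, z) \<in> R i"
      using regular_neighbour[OF YX _ xy(1) _ _ xy(4), of w] xy w by auto
    have "i \<notin> I" using fibre_eq_iff[OF F(1,2) xy(2,3,1,4)] F by simp
    then have "z \<notin> W" using fibre_eq_iff[OF F(3) F(3) w _ xy(1) z(2)] by blast
    moreover have "(z, w) \<in> R i" using R_sym xy z by blast
    ultimately show ?thesis using z w xy(1) index_setI by blast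
  qed
  \<comment> \<open>If \<open>i\<close> missed the pair \<open>U\<close>, \<open>W\<close>, then
    \<open>third\<close> would place it on \<open>V\<close>, \<open>W\<close>. Any \<open>j\<close>
    occurring on \<open>U\<close>, \<open>W\<close> would then occur on \<open>V\<close>,
    \<open>W\<close> too, and transfer along \<open>j\<close> would bring \<open>i\<close> back to
    \<open>U\<close>, \<open>W\<close>.\<close>
  have share: "index_set d R U V \<subseteq> index_set d R U W"
    if F: "U \<in> F" "V \<in> F" "W \<in> F" "U \<noteq> V" "U \<noteq> W" for U V W
  proof
    fix i assume i: "i \<in> index_set d R U V"
    show "i \<in> index_set d R U W"
    proof (rule ccontr)
      assume n: "i \<notin> index_set d R U W"
      obtain u w where "u \<in> U" "w \<in> W" using F fibre_nonempty by blast
      then obtain j where j: "j \<in> index_set d R U W"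
        using R_exists[of u w] index_setI F fibre_subset by (metis subsetD)
      have iVW: "i \<in> index_set d R V W" using third[OF F(1-4) i] n by blast
      have "j \<in> index_set d R U V \<or> j \<in> index_set d R V W"
        using third[OF F(1) F(3) F(2) F(5) j] index_set_sym by blast
      then have "j \<in> index_set d R V W" using index_set_transfer F i iVW by blast
      then show False using index_set_transfer[OF F(2) F(3) F(1) F(3) _ j iVW] n by blast
    qed
  qed
  \<comment> \<open>By \<open>share\<close> and symmetry, the endpoints of a pair of distinct fibres
    can be replaced one at a time; the case \<open>U = V'\<close> is separate because the
    intermediate pair \<open>U\<close>, \<open>V'\<close> must be distinct.\<close>
  have all: "index_set d R U V \<subseteq> index_set d R U' V'"
    if F: "U \<in> F" "V \<in> F" "U' \<in> F" "V' \<in> F" "U \<noteq> V" "U' \<noteq> V'" for U V U' V'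
  proof (cases "U = V'")
    case True
    have "index_set d R U V \<subseteq> index_set d R U U'" using share F True by blast
    then show ?thesis using True index_set_sym by blast
  next
    case False
    have "index_set d R U V \<subseteq> index_set d R U V'" using share F False by blast
    also have "\<dots> \<subseteq> index_set d R V' U" using index_set_sym by blast
    also have "\<dots> \<subseteq> index_set d R V' U'" using share F False by metis
    also have "\<dots> \<subseteq> index_set d R U' V'" using index_set_sym by blast
    finally show ?thesis .
  qed
  show ?thesis
  proof (intro ballI impI equalityI)
    fix U V assume F: "U \<in> F" "V \<in> F" "U \<noteq> V"
    show "index_set d R U V \<subseteq> {0..d} - I"
      using index_set_iff_I F unfolding index_set_def by blast
    show "{0..d} - I \<subseteq> index_set d R U V"
    proof
      fix i assume i: "i \<in> {0..d} - I"
      then obtain x y where xy: "(x, y) \<in> R i" using R_nonempty[of i] by auto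
      then obtain A B where AB: "A \<in> F" "B \<in> F" "x \<in> A" "y \<in> B"
        using R_subset[of i] i fibre_exists by (metis DiffD1 atLeastAtMost_iff)
      then have "A \<noteq> B" using fibre_eq_iff[OF AB, of i] xy i by auto
      moreover have "i \<in> index_set d R A B" using index_setI xy AB i by auto
      ultimately show "i \<in> index_set d R U V" using all AB F by blast
    qed
  qed
qed

text \<open>The constant must be independent of the fibres as well as of the points. If
  \<open>i\<close> or \<open>j\<close> is in \<open>I\<close>, the middle fibre is forced and the
  whole scheme provides the constant; otherwise the smallest unions with a single admissible middle
  fibre provide it.\<close>

lemma dismantlable_fibre_count:
  assumes reg: "\<And>G. G \<subseteq> F \<Longrightarrow> G \<noteq> {} \<Longrightarrow> regular_on d R (\<Union>G)"
    and tq: "trivial_quotient" and le: "h \<le> d" "i \<le> d" "j \<le> d"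
  shows "\<exists>c. \<forall>U\<in>F. \<forall>V\<in>F. \<forall>W\<in>F. i \<in> index_set d R U V \<longrightarrow> j \<in> index_set d R V W \<longrightarrow>
    (\<forall>x\<in>U. \<forall>y\<in>W. (x, y) \<in> R h \<longrightarrow> path_count R i j V x y = c)"
proof -
  \<comment> \<open>For fixed \<open>h\<close>, \<open>i\<close>, \<open>j\<close> this is the
    intersection number on the union of \<open>G\<close>; its value is meaningless if
    \<open>R h\<close> has no pair there.\<close>
  define f where "f G = (let (x, y) = (SOME (x, y). x \<in> \<Union>G \<and> y \<in> \<Union>G \<and> (x, y) \<in> R h) in
    path_count R i j (\<Union>G) x y)" for G
  have f: "path_count R i j (\<Union>G) x y = f G"
    if G: "G \<subseteq> F" and xy: "x \<in> \<Union>G" "y \<in> \<Union>G" "(x, y) \<in> R h" for G x y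
  proof -
    let ?P = "\<lambda>(x, y). x \<in> \<Union>G \<and> y \<in> \<Union>G \<and> (x, y) \<in> R h"
    obtain x' y' where q: "(SOME q. ?P q) = (x', y')" by fastforce
    have "?P (x', y')" using someI[of ?P "(x, y)"] xy q by simp
    then show ?thesis
      using regular_onD[OF reg le xy(1,2) _ _ xy(3), of x' y'] G xy q unfolding f_def by auto
  qed
  show ?thesis
  proof (cases "i \<in> I \<or> j \<in> I")
    case True
    have "path_count R i j V x y = f F"
      if F: "U \<in> F" "V \<in> F" "W \<in> F" and ij: "i \<in> index_set d R U V" "j \<in> index_set d R V W"
        and xy: "x \<in> U" "y \<in> W" "(x, y) \<in> R h" for U V W x y
    proof -
      \<comment> \<open>The fibre \<open>V\<close> equals \<open>U\<close> if \<open>i\<close> is in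
        \<open>I\<close> and equals \<open>W\<close> if \<open>j\<close> is, so every other fibre
        contributes nothing to the count over \<open>X\<close>.\<close>
      have "path_count R i j Z x y = 0" if Z: "Z \<in> F - {V}" for Z
        using path_count_eq_0[OF F(1) _ F(3) xy(1,2) le(2,3), of Z] Z True
          index_set_iff_I[OF F(1) F(2) ij(1)] index_set_iff_I[OF F(2) F(3) ij(2)]
          index_set_iff_I[OF F(1), of Z i] index_set_iff_I[OF _ F(3), of Z j] by blast
      then have "path_count R i j (\<Union>F) x y = path_count R i j V x y"
        unfolding path_count_fibres[OF subset_refl]
        using finite_F F by (simp add: sum.remove[of F V])
      then show ?thesis using f[of F x y] F xy by auto
    qed
    then show ?thesis by blast
  next
    case False
    \<comment> \<open>With \<open>i\<close> and \<open>j\<close> outside \<open>I\<close>, a path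
      leaves the fibre of each endpoint at once, so only fibres other than \<open>U\<close> and
      \<open>W\<close> contribute.\<close>
    have own: "path_count R i j U x y = 0" "path_count R i j W x y = 0"
      if "U \<in> F" "W \<in> F" "x \<in> U" "y \<in> W" for U W x y
      using path_count_eq_0[of U U W x y i j] path_count_eq_0[of U W W x y i j] that le False
        index_set_diag by blast+
    \<comment> \<open>The trivial quotient guarantees a test pair of \<open>R h\<close> between any
      two fibres of the right kind, at which values of \<open>f\<close> can be evaluated.\<close>
    have pair: "\<exists>x y. x \<in> U \<and> y \<in> W \<and> (x, y) \<in> R h"
      if "U \<in> F" "W \<in> F" "U = W \<longleftrightarrow> h \<in> I" for U W
      using trivial_quotient_index_set_iff[OF tq that(1,2) le(1)] that
      by (metis index_setE)
    show ?thesis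
    proof (cases "h \<in> I")
      case h: True
      have two: "path_count R i j V x y = f {U, V}"
        if F: "U \<in> F" "V \<in> F" "U \<noteq> V" and xy: "x \<in> U" "y \<in> U" "(x, y) \<in> R h" for U V x y
        using f[of "{U, V}" x y] F xy own path_count_fibres[of "{U, V}" i j x y] by auto
      have three: "f {U, A, B} = f {U, A} + f {U, B}"
        if F: "U \<in> F" "A \<in> F" "B \<in> F" "U \<noteq> A" "U \<noteq> B" "A \<noteq> B" for U A B
      proof -
        obtain x y where xy: "x \<in> U" "y \<in> U" "(x, y) \<in> R h" using pair F h by blast
        show ?thesis
          using f[of "{U, A, B}" x y] F xy own path_count_fibres[of "{U, A, B}" i j x y]
            two[of U A x y] two[of U B x y] by auto
      qed
      have const: "f S = f T" if "S \<subseteq> F" "T \<subseteq> F" "card S = 2" "card T = 2" for S T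
      proof (rule exchange_invariant_constant[where F = F and k = 2])
        fix S a b assume S: "S \<subseteq> F" "a \<in> F - S" "b \<in> F - S" "a \<noteq> b" "Suc (card S) = 2"
        then obtain s where s: "S = {s}" by (auto simp: card_1_singleton_iff)
        \<comment> \<open>Both sides equal \<open>f {s, a, b}\<close>, evaluated with endpoints in
          \<open>a\<close> and in \<open>b\<close> respectively; the common term
          \<open>f {a, b}\<close> then cancels.\<close>
        have "f {s, a} + f {a, b} = f {s, b} + f {a, b}"
          using three[of a s b] three[of b s a] S s by (auto simp: insert_commute)
        then show "f (insert a S) = f (insert b S)" using s by (simp add: insert_commute)
      qed (use that finite_F finite_subset in auto)
      \<comment> \<open>With fewer than two fibres this set is arbitrary, but then no
        \<open>S\<close> satisfies the premises of the next fact.\<close>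
      define S\<^sub>0 where "S\<^sub>0 = (SOME S. S \<subseteq> F \<and> card S = 2)"
      have S\<^sub>0: "f S = f S\<^sub>0" if "S \<subseteq> F" "card S = 2" for S
      proof -
        have "S\<^sub>0 \<subseteq> F \<and> card S\<^sub>0 = 2" unfolding S\<^sub>0_def by (rule someI[of _ S]) (use that in simp)
        then show ?thesis using const[of S S\<^sub>0] that by blast
      qed
      have "path_count R i j V x y = f S\<^sub>0"
        if F: "U \<in> F" "V \<in> F" "W \<in> F" and ij: "i \<in> index_set d R U V"
          and xy: "x \<in> U" "y \<in> W" "(x, y) \<in> R h" for U V W x y
      proof -
        have "U = W" using fibre_eq_iff[OF F(1,3) xy(1,2) le(1) xy(3)] h by simp
        moreover have "U \<noteq> V" using index_set_iff_I[OF F(1,2) ij] False by blast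
        ultimately show ?thesis using two[of U V x y] S\<^sub>0[of "{U, V}"] F xy by simp
      qed
      then show ?thesis by blast
    next
      case h: False
      \<comment> \<open>Here the endpoints lie in different fibres, so three fibres are needed to
        leave one middle fibre. The value depends only on the set of three, not on which of them is
        in the middle.\<close>
      have three: "path_count R i j V x y = f {U, V, W}"
        if F: "U \<in> F" "V \<in> F" "W \<in> F" "U \<noteq> V" "V \<noteq> W" "U \<noteq> W"
          and xy: "x \<in> U" "y \<in> W" "(x, y) \<in> R h" for U V W x y
        using f[of "{U, V, W}" x y] F xy own path_count_fibres[of "{U, V, W}" i j x y] by auto
      have four: "f {U, W, A, B} = f {U, W, A} + f {U, W, B}"
        if F: "U \<in> F" "W \<in> F" "A \<in> F" "B \<in> F" and ne: "U \<noteq> A" "U \<noteq> B" "A \<noteq> B"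
          "U \<noteq> W" "W \<noteq> A" "W \<noteq> B" for U W A B
      proof -
        obtain x y where xy: "x \<in> U" "y \<in> W" "(x, y) \<in> R h" using pair F ne h by blast
        have "path_count R i j (\<Union>{U, W, A, B}) x y =
            path_count R i j A x y + path_count R i j B x y"
          using F ne own[OF F(1,2) xy(1,2)] path_count_fibres[of "{U, W, A, B}" i j x y] by simp
        moreover have "path_count R i j A x y = f {U, W, A}" "path_count R i j B x y = f {U, W, B}"
          using three[of U A W x y] three[of U B W x y] F ne xy by (auto simp: insert_commute)
        ultimately show ?thesis using f[of "{U, W, A, B}" x y] F xy by simp
      qed
      have const: "f S = f T" if "S \<subseteq> F" "T \<subseteq> F" "card S = 3" "card T = 3" for S T
      proof (rule exchange_invariant_constant[where F = F and k = 3])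
        fix S a b assume S: "S \<subseteq> F" "a \<in> F - S" "b \<in> F - S" "a \<noteq> b" "Suc (card S) = 3"
        then have "card S = 2" by simp
        then obtain s t where s: "S = {s, t}" "s \<noteq> t" by (auto simp: card_2_iff)
        \<comment> \<open>The same four fibres are split twice, with endpoints in \<open>s\<close>,
          \<open>a\<close> and then in \<open>s\<close>, \<open>b\<close>; the term for
          \<open>{s, a, b}\<close> is common to both and cancels.\<close>
        have "f {s, a, t, b} = f {s, a, t} + f {s, a, b}"
          using four[of s a t b] S s by auto
        moreover have "f {s, b, t, a} = f {s, b, t} + f {s, b, a}"
          using four[of s b t a] S s by auto
        moreover have "{s, a, t, b} = {s, b, t, a}" "{s, a, b} = {s, b, a}"
          "{s, a, t} = insert a S" "{s, b, t} = insert b S"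
          using s by auto
        ultimately show "f (insert a S) = f (insert b S)" by simp
      qed (use that finite_F finite_subset in auto)
      define S\<^sub>0 where "S\<^sub>0 = (SOME S. S \<subseteq> F \<and> card S = 3)"
      have S\<^sub>0: "f S = f S\<^sub>0" if "S \<subseteq> F" "card S = 3" for S
      proof -
        have "S\<^sub>0 \<subseteq> F \<and> card S\<^sub>0 = 3" unfolding S\<^sub>0_def by (rule someI[of _ S]) (use that in simp)
        then show ?thesis using const[of S S\<^sub>0] that by blast
      qed
      have "path_count R i j V x y = f S\<^sub>0"
        if F: "U \<in> F" "V \<in> F" "W \<in> F"
          and ij: "i \<in> index_set d R U V" "j \<in> index_set d R V W"
          and xy: "x \<in> U" "y \<in> W" "(x, y) \<in> R h" for U V W x y
      proof -
        have "U \<noteq> W" using fibre_eq_iff[OF F(1,3) xy(1,2) le(1) xy(3)] h by simp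
        moreover have "U \<noteq> V" using index_set_iff_I[OF F(1,2) ij(1)] False by blast
        moreover have "V \<noteq> W" using index_set_iff_I[OF F(2,3) ij(2)] False by blast
        ultimately show ?thesis using three[of U V W x y] S\<^sub>0[of "{U, V, W}"] F xy by simp
      qed
      then show ?thesis by blast
    qed
  qed
qed

lemma dismantlable_imp_uniform:
  assumes "dismantlable d R F"
  shows "uniform X d R I F"
proof -
  have reg: "\<And>G. G \<subseteq> F \<Longrightarrow> G \<noteq> {} \<Longrightarrow> regular_on d R (\<Union>G)"
    using assms unfolding dismantlable_iff by blast
  note tq = dismantlable_imp_trivial_quotient[OF reg]
  \<comment> \<open>Naming the property lets one constant be chosen for each triple
    \<open>h\<close>, \<open>i\<close>, \<open>j\<close>; these choices form the coefficient
    function.\<close>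
  define Q where "Q h i j c \<longleftrightarrow>
    (\<forall>U\<in>F. \<forall>V\<in>F. \<forall>W\<in>F. i \<in> index_set d R U V \<longrightarrow> j \<in> index_set d R V W \<longrightarrow>
      (\<forall>x\<in>U. \<forall>y\<in>W. (x, y) \<in> R h \<longrightarrow> path_count R i j V x y = c))" for h i j c
  have Q: "Q h i j (SOME c. Q h i j c)" if "h \<le> d" "i \<le> d" "j \<le> d" for h i j
    using dismantlable_fibre_count[OF reg tq that] unfolding Q_def[symmetric] by (rule someI_ex)
  have "int (path_count R i j V x y) = int (SOME c. Q h i j c)"
    if F: "U \<in> F" "V \<in> F" "W \<in> F"
      and ij: "i \<in> index_set d R U V" "j \<in> index_set d R V W"
      and h: "h \<le> d" "x \<in> U" "y \<in> W" "(x, y) \<in> R h" for U V W h i j x y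
  proof -
    have "i \<le> d" "j \<le> d" using ij unfolding index_set_def by simp_all
    from Q[OF h(1) this] have "path_count R i j V x y = (SOME c. Q h i j c)"
      unfolding Q_def[of h i j "Eps (Q h i j)"] using F ij h by blast
    then show ?thesis by simp
  qed
  then have "\<forall>U\<in>F. \<forall>V\<in>F. \<forall>W\<in>F. \<forall>i\<in>index_set d R U V. \<forall>j\<in>index_set d R V W.
      \<forall>h\<le>d. \<forall>x\<in>U. \<forall>y\<in>W. (x, y) \<in> R h \<longrightarrow>
        int (path_count R i j V x y) = int (SOME c. Q h i j c)"
    by simp
  then show ?thesis
    unfolding uniform_iff using tq by (intro conjI exI[of _ "\<lambda>h i j. int (SOME c. Q h i j c)"])
qed

end

theorem theorem4p3:
  fixes X :: "'a set" and d :: nat and R :: "nat \<Rightarrow> ('a \<times> 'a) set"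
    and I :: "nat set" and F :: "'a set set"
  assumes "association_scheme X d R"
    and "imprimitive X d R"
    and "imprimitivity_system X d R I F"
  shows "dismantlable d R F \<longleftrightarrow> uniform X d R I F"
proof -
  interpret fibred_scheme X d R I F
    using assms by unfold_locales
  show ?thesis
    using dismantlable_imp_uniform uniform_imp_dismantlable by blast
qed

end
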